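(* Let $\{T_\theta\}_{\theta\in U}$ satisfy the standing assumptions (i)–(iv) of the context, and let $\{\theta_\varepsilon^{c}\}_{\varepsilon\downarrow0}$ be a center family. Let $r\ge2$ and let $\{\mathcal S_\varepsilon^i\}_{\varepsilon\downarrow0}$, $i\in\{1,\dots,r\}$, be slow region families of the same $\{\theta_\varepsilon^{c}\}_{\varepsilon\downarrow0}$, with vanishing moduli $\rho_\varepsilon^i$. Then $\{\bigcup_{i=1}^r\mathcal S_\varepsilon^i\}_{\varepsilon\downarrow0}$ is a slow region family of $\{\theta_\varepsilon^{c}\}_{\varepsilon\downarrow0}$ whose vanishing modulus is exactly $\max_{1\le i\le r}\rho_\varepsilon^i$.
   Context: **Setting.** $\mathcal X,\mathcal Y,\mathcal H$ are finite-dimensional real Hilbert spaces, $\mathcal K\subseteq\mathcal X$ is a closed convex cone with dual cone $\mathcal K^*$. A parameter is $\theta=(\mathcal A,b,c)\in\mathcal D:=\mathcal L(\mathcal X,\mathcal Y)\times\mathcal Y\times\mathcal X$ (with $\mathcal L(\mathcal X,\mathcal Y)$ the linear maps), normed by $\|\theta\|_{\mathcal D}^2:=\|\mathcal A\|_{\mathrm{HS}}^2+\|b\|_{\mathcal Y}^2+\|c\|_{\mathcal X}^2$. Put $\mathrm{KKT}(\theta):=\{(x,y,s):\mathcal Ax=b,\ \mathcal A^*y+s=c,\ \langle x,s\rangle_{\mathcal X}=0,\ x\in\mathcal K,\ s\in\mathcal K^*\}$ and $\mathcal D_{\mathrm{KKT}}:=\{\theta\in\mathcal D:\mathrm{KKT}(\theta)\ne\emptyset\}$.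 Let $\bar\theta\in\mathrm{cl}(\mathcal D_{\mathrm{KKT}})$ and let $U\subset\mathcal D$ be compact with $\bar\theta\in U$. To each $\theta\in U$ is associated a map $T_\theta:\mathcal H\to\mathcal H$, with residual map $\delta_\theta:=T_\theta-\mathrm{Id}$ and fixed point set $\mathrm{Fix}(T_\theta)$. **Standing assumptions.** (i) For every $\theta\in U$: $\mathrm{Fix}(T_\theta)\ne\emptyset$ iff $\theta\in\mathcal D_{\mathrm{KKT}}$. (ii) For every $\theta\in U$, $T_\theta$ is $\alpha_\theta$-averaged for some $\alpha_\theta\in(0,1)$ (i.e. $T_\theta=(1-\alpha_\theta)\mathrm{Id}+\alpha_\theta N_\theta$ with $N_\theta$ nonexpansive) with respect to the inner product $\langle z,w\rangle_\theta:=\langle z,G_\theta w\rangle_{\mathcal H}$, $G_\theta$ self-adjoint positive definite on $\mathcal H$. (iii) There are $0<m_U\le M_U<\infty$ with $m_U\mathrm{Id}\preceq G_\theta\preceq M_U\mathrm{Id}$ for all $\theta\in U$. (iv) There is $L_U(r)=a+a'r$ with $a,a'\ge0$ such that $\|T_\theta z-T_{\theta'}z\|_{\mathcal H}\le L_U(\|z\|_{\mathcal H})\,\|\theta-\theta'\|_{\mathcal D}$ for all $\theta,\theta'\in U$, $z\in\mathcal H$. **Families.** All conditions on families indexed by $\varepsilon\downarrow0$ are required only for all sufficiently small $\varepsilon>0$. A center family is $\{\theta_\varepsilon^{c}\}_{\varepsilon\downarrow0}\subset U\cap\mathcal D_{\mathrm{KKT}}$ with $\theta_\varepsilon^{c}\to\bar\theta$.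 Write $T_\varepsilon^{c}:=T_{\theta_\varepsilon^{c}}$, $\delta_\varepsilon^{c}:=\delta_{\theta_\varepsilon^{c}}$, $V_\varepsilon^{c}:=\mathrm{Fix}(T_\varepsilon^{c})$. $\mathrm{dist}_{\mathcal H}$ is the distance in $\|\cdot\|_{\mathcal H}$. **Slow region (SR) family.** A set family $\{\mathcal S_\varepsilon\}_{\varepsilon\downarrow0}$ of subsets of $\mathcal H$ is an SR family of $\{\theta_\varepsilon^{c}\}$ iff (1) $\mathcal S_\varepsilon\ne\emptyset$ and $\mathcal S_\varepsilon\cap V_\varepsilon^{c}=\emptyset$; (2) its vanishing modulus $\rho_\varepsilon:=\sup_{z\in\mathcal S_\varepsilon}\|\delta_\varepsilon^{c}(z)\|_{\mathcal H}/\mathrm{dist}_{\mathcal H}(z,V_\varepsilon^{c})$ is finite and $\rho_\varepsilon\to0$ as $\varepsilon\downarrow0$. *)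

theory Defs
  imports "HOL-Analysis.Analysis"
begin

text \<open>
  Finite-dimensional real Hilbert spaces are types of class \<open>euclidean_space\<close>. On such spaces every
  linear map is bounded, so \<open>'x \<Rightarrow>\<^sub>L 'y\<close> is the space of all linear maps.
\<close>

type_synonym ('x, 'y) param = "('x \<Rightarrow>\<^sub>L 'y) \<times> 'y \<times> 'x"


section \<open>The parameter space and the KKT system\<close>

definition hs_norm :: "('x::euclidean_space \<Rightarrow>\<^sub>L 'y::euclidean_space) \<Rightarrow> real" where
  "hs_norm A = sqrt (\<Sum>b\<in>Basis. (norm (blinfun_apply A b))\<^sup>2)"

text \<open>
  The norm of the parameter space. The instance norm on \<open>param\<close> is built from the operator norm and
  is a different, but equivalent, norm (lemma \<open>param_norm_equivalent\<close>). Compactness, closure and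
  convergence in \<open>param\<close> can therefore be taken in the instance topology.
\<close>

definition param_norm :: "('x::euclidean_space, 'y::euclidean_space) param \<Rightarrow> real" where
  "param_norm \<theta> = (case \<theta> of (A, b, c) \<Rightarrow> sqrt ((hs_norm A)\<^sup>2 + (norm b)\<^sup>2 + (norm c)\<^sup>2))"

lemma hs_norm_nonneg: "0 \<le> hs_norm A"
  by (simp add: hs_norm_def sum_nonneg)

lemma norm_le_hs_norm:
  fixes A :: "'x::euclidean_space \<Rightarrow>\<^sub>L 'y::euclidean_space"
  shows "norm A \<le> real DIM('x) * hs_norm A"
proof -
  have "norm (blinfun_apply A b) \<le> hs_norm A" if "b \<in> Basis" for b
  proof -
    have "(norm (blinfun_apply A b))\<^sup>2 \<le> (\<Sum>b\<in>Basis. (norm (blinfun_apply A b))\<^sup>2)"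
      using that by (intro member_le_sum) auto
    then show ?thesis
      unfolding hs_norm_def by (rule real_le_rsqrt)
  qed
  then have "(\<Sum>b\<in>Basis. norm (blinfun_apply A b)) \<le> real DIM('x) * hs_norm A"
    by (rule sum_bounded_above)
  with norm_blinfun_euclidean_le[of A] show ?thesis
    by linarith
qed

lemma hs_norm_le_norm:
  fixes A :: "'x::euclidean_space \<Rightarrow>\<^sub>L 'y::euclidean_space"
  shows "hs_norm A \<le> real DIM('x) * norm A"
proof -
  have "hs_norm A \<le> (\<Sum>b\<in>Basis. norm (blinfun_apply A b))"
    using L2_set_le_sum[of Basis "\<lambda>b. norm (blinfun_apply A b)"]
    by (simp add: hs_norm_def L2_set_def)
  also have "\<dots> \<le> real DIM('x) * norm A"
  proof (rule sum_bounded_above)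
    fix b :: 'x assume "b \<in> Basis"
    then show "norm (blinfun_apply A b) \<le> norm A"
      using norm_blinfun[of A b] by simp
  qed
  finally show ?thesis .
qed

lemma param_norm_equivalent:
  fixes \<theta> :: "('x::euclidean_space, 'y::euclidean_space) param"
  shows "norm \<theta> \<le> real DIM('x) * param_norm \<theta>"
    and "param_norm \<theta> \<le> real DIM('x) * norm \<theta>"
proof -
  obtain A b c where \<theta>: "\<theta> = (A, b, c)"
    by (cases \<theta>)
  define d where "d = real DIM('x)"
  have d: "1 \<le> d"
    using DIM_positive[where 'a='x] by (simp add: d_def)
  then have d2: "1 \<le> d\<^sup>2"
    by simp
  have grow: "t\<^sup>2 \<le> d\<^sup>2 * t\<^sup>2" for t :: real
    using mult_right_mono[OF d2, of "t\<^sup>2"] by simp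
  have n: "norm \<theta> = sqrt ((norm A)\<^sup>2 + (norm b)\<^sup>2 + (norm c)\<^sup>2)"
    by (simp add: \<theta> norm_Pair add.assoc)
  have p: "param_norm \<theta> = sqrt ((hs_norm A)\<^sup>2 + (norm b)\<^sup>2 + (norm c)\<^sup>2)"
    by (simp add: \<theta> param_norm_def)
  have pull: "sqrt (d\<^sup>2 * r) = d * sqrt r" for r
    using d by (simp add: real_sqrt_mult)
  have "(norm A)\<^sup>2 \<le> d\<^sup>2 * (hs_norm A)\<^sup>2"
    using power_mono[OF norm_le_hs_norm[of A], of 2] by (simp add: d_def power_mult_distrib)
  then have "norm \<theta> \<le> sqrt (d\<^sup>2 * ((hs_norm A)\<^sup>2 + (norm b)\<^sup>2 + (norm c)\<^sup>2))"
    unfolding n using grow[of "norm b"] grow[of "norm c"]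
    by (intro real_sqrt_le_mono) (simp add: distrib_left)
  then show "norm \<theta> \<le> real DIM('x) * param_norm \<theta>"
    unfolding pull p by (simp add: d_def)
  have "(hs_norm A)\<^sup>2 \<le> d\<^sup>2 * (norm A)\<^sup>2"
    using power_mono[OF hs_norm_le_norm[of A] hs_norm_nonneg, of 2]
    by (simp add: d_def power_mult_distrib)
  then have "param_norm \<theta> \<le> sqrt (d\<^sup>2 * ((norm A)\<^sup>2 + (norm b)\<^sup>2 + (norm c)\<^sup>2))"
    unfolding p using grow[of "norm b"] grow[of "norm c"]
    by (intro real_sqrt_le_mono) (simp add: distrib_left)
  then show "param_norm \<theta> \<le> real DIM('x) * norm \<theta>"
    unfolding pull n by (simp add: d_def)
qed

text \<open>The library's \<open>cone\<close> admits the empty set, which is excluded here.\<close>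

definition closed_convex_cone :: "'x::euclidean_space set \<Rightarrow> bool" where
  "closed_convex_cone K \<longleftrightarrow> K \<noteq> {} \<and> closed K \<and> convex K \<and> cone K"

definition dual_cone :: "'x::euclidean_space set \<Rightarrow> 'x set" where
  "dual_cone K = {s. \<forall>x\<in>K. 0 \<le> x \<bullet> s}"

definition KKT ::
  "'x::euclidean_space set \<Rightarrow> ('x, 'y::euclidean_space) param \<Rightarrow> ('x \<times> 'y \<times> 'x) set" where
  "KKT K \<theta> = (case \<theta> of (A, b, c) \<Rightarrow>
     {(x, y, s). blinfun_apply A x = b \<and> adjoint (blinfun_apply A) y + s = c \<and> x \<bullet> s = 0 \<and>
                 x \<in> K \<and> s \<in> dual_cone K})"

definition D_KKT :: "'x::euclidean_space set \<Rightarrow> ('x, 'y::euclidean_space) param set" where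
  "D_KKT K = {\<theta>. KKT K \<theta> \<noteq> {}}"


section \<open>Averaged maps and the standing assumptions\<close>

definition Fix :: "('h \<Rightarrow> 'h) \<Rightarrow> 'h set" where
  "Fix f = {z. f z = z}"

definition residual :: "('h::euclidean_space \<Rightarrow> 'h) \<Rightarrow> 'h \<Rightarrow> 'h" where
  "residual f z = f z - z"

definition self_adjoint :: "('h::euclidean_space \<Rightarrow> 'h) \<Rightarrow> bool" where
  "self_adjoint G \<longleftrightarrow> linear G \<and> (\<forall>z w. G z \<bullet> w = z \<bullet> G w)"

definition positive_definite :: "('h::euclidean_space \<Rightarrow> 'h) \<Rightarrow> bool" where
  "positive_definite G \<longleftrightarrow> (\<forall>z. z \<noteq> 0 \<longrightarrow> 0 < z \<bullet> G z)"

definition loewner_le ::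
  "('h::euclidean_space \<Rightarrow> 'h) \<Rightarrow> ('h \<Rightarrow> 'h) \<Rightarrow> bool" where
  "loewner_le G G' \<longleftrightarrow> (\<forall>z. z \<bullet> G z \<le> z \<bullet> G' z)"

definition weighted_norm :: "('h::euclidean_space \<Rightarrow> 'h) \<Rightarrow> 'h \<Rightarrow> real" where
  "weighted_norm G z = sqrt (z \<bullet> G z)"

definition nonexpansive_wrt ::
  "('h::euclidean_space \<Rightarrow> 'h) \<Rightarrow> ('h \<Rightarrow> 'h) \<Rightarrow> bool" where
  "nonexpansive_wrt G N \<longleftrightarrow> (\<forall>z w. weighted_norm G (N z - N w) \<le> weighted_norm G (z - w))"

definition averaged_wrt ::
  "('h::euclidean_space \<Rightarrow> 'h) \<Rightarrow> real \<Rightarrow> ('h \<Rightarrow> 'h) \<Rightarrow> bool" where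
  "averaged_wrt G \<alpha> f \<longleftrightarrow>
     (\<exists>N. nonexpansive_wrt G N \<and> (\<forall>z. f z = (1 - \<alpha>) *\<^sub>R z + \<alpha> *\<^sub>R N z))"

text \<open>
  \<open>T\<close> and \<open>G\<close> are total functions of the parameter; only their values on \<open>U\<close> are constrained.
\<close>

definition standing_assumptions ::
  "'x::euclidean_space set \<Rightarrow> ('x, 'y::euclidean_space) param set \<Rightarrow>
   (('x, 'y) param \<Rightarrow> 'h::euclidean_space \<Rightarrow> 'h) \<Rightarrow> (('x, 'y) param \<Rightarrow> 'h \<Rightarrow> 'h) \<Rightarrow> bool" where
  "standing_assumptions K U T G \<longleftrightarrow>
     (\<forall>\<theta>\<in>U. Fix (T \<theta>) \<noteq> {} \<longleftrightarrow> \<theta> \<in> D_KKT K) \<and>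
     (\<forall>\<theta>\<in>U. self_adjoint (G \<theta>) \<and> positive_definite (G \<theta>) \<and>
            (\<exists>\<alpha>. 0 < \<alpha> \<and> \<alpha> < 1 \<and> averaged_wrt (G \<theta>) \<alpha> (T \<theta>))) \<and>
     (\<exists>m M. 0 < m \<and> m \<le> M \<and>
            (\<forall>\<theta>\<in>U. loewner_le (\<lambda>z. m *\<^sub>R z) (G \<theta>) \<and> loewner_le (G \<theta>) (\<lambda>z. M *\<^sub>R z))) \<and>
     (\<exists>a a'. 0 \<le> a \<and> 0 \<le> a' \<and>
            (\<forall>\<theta>\<in>U. \<forall>\<theta>'\<in>U. \<forall>z.
               norm (T \<theta> z - T \<theta>' z) \<le> (a + a' * norm z) * param_norm (\<theta> - \<theta>')))"


section \<open>Center families and slow regions\<close>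

text \<open>
  A family indexed by \<open>\<epsilon> \<down> 0\<close> is a function of \<open>\<epsilon> :: real\<close>, and what is required of it is required
  eventually along \<open>at_right 0\<close>, that is for all sufficiently small \<open>\<epsilon> > 0\<close>.
\<close>

definition center_family ::
  "'x::euclidean_space set \<Rightarrow> ('x, 'y::euclidean_space) param set \<Rightarrow> ('x, 'y) param \<Rightarrow>
   (real \<Rightarrow> ('x, 'y) param) \<Rightarrow> bool" where
  "center_family K U \<theta>bar \<theta>c \<longleftrightarrow>
     (\<forall>\<^sub>F \<epsilon> in at_right 0. \<theta>c \<epsilon> \<in> U \<inter> D_KKT K) \<and> (\<theta>c \<longlongrightarrow> \<theta>bar) (at_right 0)"

text \<open>
  The supremum is taken in \<open>ereal\<close>, so that an unbounded ratio gives \<open>\<infinity>\<close>. The library's \<open>infdist\<close>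
  is the usual distance to a nonempty set. The fixed point set of an averaged map is closed, hence
  the denominator is positive at every point of a slow region.
\<close>

definition vanishing_modulus ::
  "('p \<Rightarrow> 'h::euclidean_space \<Rightarrow> 'h) \<Rightarrow> (real \<Rightarrow> 'p) \<Rightarrow> (real \<Rightarrow> 'h set) \<Rightarrow> real \<Rightarrow> ereal" where
  "vanishing_modulus T \<theta>c S \<epsilon> =
     (SUP z\<in>S \<epsilon>. ereal (norm (residual (T (\<theta>c \<epsilon>)) z) / infdist z (Fix (T (\<theta>c \<epsilon>)))))"

definition slow_region_family ::
  "('p \<Rightarrow> 'h::euclidean_space \<Rightarrow> 'h) \<Rightarrow> (real \<Rightarrow> 'p) \<Rightarrow> (real \<Rightarrow> 'h set) \<Rightarrow> bool" where
  "slow_region_family T \<theta>c S \<longleftrightarrow>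
     (\<forall>\<^sub>F \<epsilon> in at_right 0. S \<epsilon> \<noteq> {} \<and> S \<epsilon> \<inter> Fix (T (\<theta>c \<epsilon>)) = {}) \<and>
     (\<forall>\<^sub>F \<epsilon> in at_right 0. \<bar>vanishing_modulus T \<theta>c S \<epsilon>\<bar> \<noteq> \<infinity>) \<and>
     (vanishing_modulus T \<theta>c S \<longlongrightarrow> 0) (at_right 0)"

end

theory Submission
  imports Defs
begin

text \<open>
  The vanishing modulus is a supremum of the ratios over the points of the set, and all
  families share one center, so the ratio at a point does not depend on the set it is taken from.
  A supremum over a union is the supremum of the suprema (\<open>vanishing_modulus_UNION\<close>). With finitely
  many sets the outer supremum is attained: the modulus of the union equals, at every \<open>\<epsilon>\<close>, one of
  the given moduli, hence it is finite as soon as they all are; and a finite maximum of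
  functions tending to \<open>0\<close> tends to \<open>0\<close> (\<open>tendsto_Max_image\<close>). The two set conditions pass to the
  union because only finitely many thresholds on \<open>\<epsilon>\<close> have to be met at the same time.
\<close>

lemma tendsto_Max_image:
  fixes f :: "'i \<Rightarrow> 'a \<Rightarrow> 'b::linorder_topology"
  assumes "finite I" and "I \<noteq> {}" and "\<And>i. i \<in> I \<Longrightarrow> (f i \<longlongrightarrow> l i) F"
  shows "((\<lambda>x. MAX i\<in>I. f i x) \<longlongrightarrow> (MAX i\<in>I. l i)) F"
  using assms by (induction I rule: finite_ne_induct) (simp_all add: tendsto_max)

text \<open>
  The supremum of the empty set in \<open>ereal\<close> is \<open>-\<infinity>\<close>, which is neutral for the maximum, so the
  identity holds at every \<open>\<epsilon>\<close> and not only for small \<open>\<epsilon>\<close>. It can therefore rewrite the modulus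
  as a function inside a limit.
\<close>

lemma vanishing_modulus_UNION:
  assumes "finite I" and "I \<noteq> {}"
  shows "vanishing_modulus T \<theta>c (\<lambda>\<epsilon>. \<Union>i\<in>I. S i \<epsilon>) \<epsilon> = (MAX i\<in>I. vanishing_modulus T \<theta>c (S i) \<epsilon>)"
proof -
  have "vanishing_modulus T \<theta>c (\<lambda>\<epsilon>. \<Union>i\<in>I. S i \<epsilon>) \<epsilon> = (SUP i\<in>I. vanishing_modulus T \<theta>c (S i) \<epsilon>)"
    unfolding vanishing_modulus_def by (rule SUP_UNION)
  also have "\<dots> = (MAX i\<in>I. vanishing_modulus T \<theta>c (S i) \<epsilon>)"
    using assms by (simp add: Max_Sup)
  finally show ?thesis .
qed

lemma slow_region_family_UNION:
  assumes "finite I" and "I \<noteq> {}" and S: "\<And>i. i \<in> I \<Longrightarrow> slow_region_family T \<theta>c (S i)"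
  shows "slow_region_family T \<theta>c (\<lambda>\<epsilon>. \<Union>i\<in>I. S i \<epsilon>)"
proof -
  note modulus = vanishing_modulus_UNION[OF assms(1,2)]
  have "\<forall>\<^sub>F \<epsilon> in at_right 0. \<forall>i\<in>I. S i \<epsilon> \<noteq> {} \<and> S i \<epsilon> \<inter> Fix (T (\<theta>c \<epsilon>)) = {}"
    using S \<open>finite I\<close> by (simp add: eventually_ball_finite slow_region_family_def)
  then have "\<forall>\<^sub>F \<epsilon> in at_right 0. (\<Union>i\<in>I. S i \<epsilon>) \<noteq> {} \<and> (\<Union>i\<in>I. S i \<epsilon>) \<inter> Fix (T (\<theta>c \<epsilon>)) = {}"
    by (rule eventually_mono) (use \<open>I \<noteq> {}\<close> in blast)
  moreover have "\<forall>\<^sub>F \<epsilon> in at_right 0. \<forall>i\<in>I. \<bar>vanishing_modulus T \<theta>c (S i) \<epsilon>\<bar> \<noteq> \<infinity>"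
    using S \<open>finite I\<close> by (simp add: eventually_ball_finite slow_region_family_def)
  then have "\<forall>\<^sub>F \<epsilon> in at_right 0. \<bar>vanishing_modulus T \<theta>c (\<lambda>\<epsilon>. \<Union>i\<in>I. S i \<epsilon>) \<epsilon>\<bar> \<noteq> \<infinity>"
  proof (rule eventually_mono)
    fix \<epsilon>
    assume fin: "\<forall>i\<in>I. \<bar>vanishing_modulus T \<theta>c (S i) \<epsilon>\<bar> \<noteq> \<infinity>"
    have "(MAX i\<in>I. vanishing_modulus T \<theta>c (S i) \<epsilon>) \<in> (\<lambda>i. vanishing_modulus T \<theta>c (S i) \<epsilon>) ` I"
      using assms(1,2) by (intro Max_in) auto
    with fin show "\<bar>vanishing_modulus T \<theta>c (\<lambda>\<epsilon>. \<Union>i\<in>I. S i \<epsilon>) \<epsilon>\<bar> \<noteq> \<infinity>"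
      unfolding modulus by fastforce
  qed
  moreover have "(vanishing_modulus T \<theta>c (\<lambda>\<epsilon>. \<Union>i\<in>I. S i \<epsilon>) \<longlongrightarrow> 0) (at_right 0)"
  proof -
    have "((\<lambda>\<epsilon>. MAX i\<in>I. vanishing_modulus T \<theta>c (S i) \<epsilon>) \<longlongrightarrow> (MAX i\<in>I. 0)) (at_right 0)"
      using S by (intro tendsto_Max_image assms(1,2)) (simp add: slow_region_family_def)
    moreover have "(MAX i\<in>I. 0 :: ereal) = 0"
      using \<open>I \<noteq> {}\<close> by (simp add: image_constant_conv)
    ultimately show ?thesis
      by (simp add: modulus[abs_def])
  qed
  ultimately show ?thesis
    unfolding slow_region_family_def by blast
qed

theorem proposition2p5:
  fixes K :: "'x::euclidean_space set"
    and U :: "('x, 'y::euclidean_space) param set"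
    and \<theta>bar :: "('x, 'y) param"
    and T G :: "('x, 'y) param \<Rightarrow> 'h::euclidean_space \<Rightarrow> 'h"
    and \<theta>c :: "real \<Rightarrow> ('x, 'y) param"
    and r :: nat
    and S :: "nat \<Rightarrow> real \<Rightarrow> 'h set"
  assumes "closed_convex_cone K"
    and "\<theta>bar \<in> closure (D_KKT K)"
    and "compact U" and "\<theta>bar \<in> U"
    and "standing_assumptions K U T G"
    and "center_family K U \<theta>bar \<theta>c"
    and "2 \<le> r"
    and "\<And>i. i \<in> {1..r} \<Longrightarrow> slow_region_family T \<theta>c (S i)"
  shows "slow_region_family T \<theta>c (\<lambda>\<epsilon>. \<Union>i\<in>{1..r}. S i \<epsilon>) \<and>
    (\<forall>\<^sub>F \<epsilon> in at_right 0.
       vanishing_modulus T \<theta>c (\<lambda>\<epsilon>. \<Union>i\<in>{1..r}. S i \<epsilon>) \<epsilon>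
         = (MAX i\<in>{1..r}. vanishing_modulus T \<theta>c (S i) \<epsilon>))"
proof -
  have "finite {1..r}" and "{1..r} \<noteq> {}"
    using \<open>2 \<le> r\<close> by auto
  from slow_region_family_UNION[OF this assms(8)] vanishing_modulus_UNION[OF this]
  show ?thesis
    by (intro conjI always_eventually allI)
qed

end
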